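(* Let $n\in\mathbb{N}$, $x^{(0)}\in\mathbb{R}^n$, $R>0$, $B=B(x^{(0)};R)$, let $S$ be a regular $n$-dimensional simplex inscribed into $B$, and let $P:C(B)\to\Pi_1(\mathbb{R}^n)$ be the interpolation projector whose nodes are the vertices of $S$. For $0\le t\le n+1$ put $$\psi(t)=\frac{2\sqrt n}{n+1}\bigl(t(n+1-t)\bigr)^{1/2}+\left|1-\frac{2t}{n+1}\right|,$$ and let $a=\left\lfloor\frac{n+1}{2}-\frac{\sqrt{n+1}}{2}\right\rfloor$. Then $$\|P\|_B=\max\{\psi(a),\psi(a+1)\}$$ and $$\sqrt n\le\|P\|_B\le\sqrt{n+1}.$$ The equality $\|P\|_B=\sqrt n$ is true only for $n=1$. The equality $\|P\|_B=\sqrt{n+1}$ holds if and only if $\sqrt{n+1}$ is an integer.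
   Context: $\|x\|=\left(\sum_{i=1}^n x_i^2\right)^{1/2}$ is the Euclidean norm on $\mathbb{R}^n$, and $B(x^{(0)};R)=\{x\in\mathbb{R}^n:\|x-x^{(0)}\|\le R\}$. A simplex is inscribed into the ball $B(x^{(0)};R)$ if all its vertices lie on the boundary sphere $\|x-x^{(0)}\|=R$; it is regular if all its edges have equal length (simplices are nondegenerate). $C(B)$ is the space of continuous functions $f:B\to\mathbb{R}$ with norm $\|f\|_{C(B)}=\max_{x\in B}|f(x)|$. $\Pi_1(\mathbb{R}^n)$ is the set of real polynomials in $n$ variables of degree at most $1$. The interpolation projector $P:C(B)\to\Pi_1(\mathbb{R}^n)$ with nodes $x^{(1)},\dots,x^{(n+1)}\in B$ (the vertices of a nondegenerate simplex) is determined by $Pf(x^{(j)})=f(x^{(j)})$ for $1\le j\le n+1$. $\|P\|_B$ is the norm of $P$ as an operator from $C(B)$ to $C(B)$ (with $Pf$ restricted to $B$). $\lfloor s\rfloor$ denotes the integer part of $s$. *)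

theory Defs
  imports "HOL-Analysis.Analysis"
begin

definition vertices :: "'a::euclidean_space set \<Rightarrow> 'a set" where
  "vertices S = {v. v extreme_point_of S}"

(* Every edge of a polytope is a closed segment. *)
definition equal_edges :: "'a::euclidean_space set \<Rightarrow> bool" where
  "equal_edges S \<longleftrightarrow> (\<exists>l. \<forall>u v. closed_segment u v edge_of S \<longrightarrow> dist u v = l)"

definition regular_simplex :: "int \<Rightarrow> 'a::euclidean_space set \<Rightarrow> bool" where
  "regular_simplex n S \<longleftrightarrow> n simplex S \<and> equal_edges S"

definition inscribed_in_ball :: "'a::euclidean_space set \<Rightarrow> 'a \<Rightarrow> real \<Rightarrow> bool" where
  "inscribed_in_ball S x0 R \<longleftrightarrow> vertices S \<subseteq> sphere x0 R"

(* Elements of C(B) are represented by total functions that are continuous on B; their values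
   outside B are irrelevant to everything below. *)
definition cont_fun_space :: "'a::topological_space set \<Rightarrow> ('a \<Rightarrow> real) set" where
  "cont_fun_space B = {f. continuous_on B f}"

(* For f continuous on a nonempty compact B the supremum is attained, i.e. it is the maximum. *)
definition sup_norm :: "'a set \<Rightarrow> ('a \<Rightarrow> real) \<Rightarrow> real" where
  "sup_norm B f = (SUP x\<in>B. \<bar>f x\<bar>)"

(* Norm of T as an operator from C(B) to C(B).  As everywhere for real suprema, the value is
   meaningful only for bounded sets, i.e. for bounded T; interpolation projectors are bounded. *)
definition operator_norm ::
    "'a::topological_space set \<Rightarrow> (('a \<Rightarrow> real) \<Rightarrow> ('a \<Rightarrow> real)) \<Rightarrow> real" where
  "operator_norm B T = (SUP f\<in>{f \<in> cont_fun_space B. sup_norm B f \<le> 1}. sup_norm B (T f))"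

definition polys_deg_le_1 :: "(real ^ 'n \<Rightarrow> real) set" where
  "polys_deg_le_1 = {p. \<exists>c0 c. \<forall>x. p x = c0 + (\<Sum>i\<in>UNIV. c i * x $ i)}"

definition interpolation_projector ::
    "(real ^ 'n) set \<Rightarrow> (real ^ 'n) set \<Rightarrow> ((real ^ 'n \<Rightarrow> real) \<Rightarrow> (real ^ 'n \<Rightarrow> real)) \<Rightarrow> bool" where
  "interpolation_projector B V P \<longleftrightarrow>
     V \<subseteq> B \<and>
     (\<forall>f \<in> cont_fun_space B. P f \<in> polys_deg_le_1 \<and> (\<forall>v \<in> V. P f v = f v))"

(* Meaningful for 0 \<le> t \<le> n + 1, where the argument of the second root is nonnegative. *)
definition psi :: "nat \<Rightarrow> real \<Rightarrow> real" where
  "psi n t = 2 * sqrt (real n) / (real n + 1) * sqrt (t * (real n + 1 - t))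
             + \<bar>1 - 2 * t / (real n + 1)\<bar>"

definition split_index :: "nat \<Rightarrow> int" where
  "split_index n = \<lfloor>(real n + 1) / 2 - sqrt (real n + 1) / 2\<rfloor>"

end

theory Submission
  imports Defs
begin

text \<open>
  Write \<open>n\<close> for the dimension. The proof rests on an explicit form of the barycentric coordinates.
  Let \<open>u v = v - x0\<close> for a vertex \<open>v\<close>. Equal edge lengths make all mixed inner products
  \<open>u v \<bullet> u w\<close> equal, so \<open>\<Sum>u\<close> has the same inner product with every \<open>u v\<close>. It is therefore
  orthogonal to all edges, and since these span the space it vanishes. Hence
  \<open>u v \<bullet> u w = - R\<^sup>2 / n\<close> for \<open>v \<noteq> w\<close>, and the \<open>v\<close>-th barycentric coordinate of \<open>x\<close> is
  \<open>1 / (n + 1) + n / ((n + 1) * R\<^sup>2) * (u v \<bullet> (x - x0))\<close>.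

  These coordinates are the Lagrange basis of \<open>P\<close>, so the norm of \<open>P\<close> is the maximum over the ball
  of the Lebesgue function, the sum of their absolute values. Choosing the signs first turns this
  into a family of linear maximization problems: for a set \<open>A\<close> of \<open>k\<close> vertices that carry a minus
  sign, the maximum over the ball depends on the length of \<open>\<Sum>v\<in>A. u v\<close> only, and that length
  depends on \<open>k\<close> only (\<open>norm_sum_subset\<close>). The value is \<open>half_psi n k\<close>, which is \<open>psi\<close> without its
  absolute value. As \<open>psi n t\<close> is the larger of \<open>half_psi n t\<close> and \<open>half_psi n (n + 1 - t)\<close>, the norm
  is the largest \<open>psi n k\<close> over the integers \<open>k\<close> between \<open>0\<close> and \<open>n + 1\<close>.

  What remains concerns one real variable. The function \<open>half_psi n\<close> increases up to
  \<open>(n + 1) / 2 - sqrt (n + 1) / 2\<close> and decreases afterwards, so among the integers it is largest next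
  to this point (\<open>psi_le_max_split_index\<close>). With \<open>q = sqrt (t * (n + 1 - t))\<close> and
  \<open>s = (n + 1) / 2 - t\<close>, the identity \<open>psi_square\<close> expresses \<open>n + 1 - psi\<^sup>2\<close> as the square of a
  multiple of \<open>q - sqrt n * \<bar>s\<bar>\<close>. This gives the upper bound, with equality exactly for
  \<open>2 * \<bar>s\<bar> = sqrt (n + 1)\<close>. As \<open>2 * s\<close> is an integer at integers \<open>t\<close>, equality forces \<open>sqrt (n + 1)\<close>
  to be an integer; conversely \<open>r\<^sup>2 - r\<close> is even, so an integral root makes the maximum point itself
  an integer. Finally, for \<open>n \<ge> 2\<close> an integer at distance \<open>1/2\<close> or \<open>1\<close> from the midpoint
  \<open>(n + 1) / 2\<close> gives a value of \<open>psi\<close> strictly above \<open>sqrt n\<close>.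
\<close>

section \<open>The function \<open>psi\<close> at integers\<close>

text \<open>
  The value attached to \<open>t\<close> vertices with a minus sign. Dropping the absolute value makes the
  function unimodal; the symmetry \<open>t \<mapsto> n + 1 - t\<close>, which flips all signs, recovers \<open>psi\<close>.
\<close>

definition half_psi :: "nat \<Rightarrow> real \<Rightarrow> real" where
  "half_psi n t = 2 * sqrt n / (real n + 1) * sqrt (t * (real n + 1 - t)) + (1 - 2 * t / (real n + 1))"

lemma psi_eq_max_half_psi:
  "psi n t = max (half_psi n t) (half_psi n (real n + 1 - t))"
proof -
  have abs: "a + \<bar>b\<bar> = max (a + b) (a + - b)" for a b :: real by linarith
  have "1 - 2 * (real n + 1 - t) / (real n + 1) = - (1 - 2 * t / (real n + 1))"
    by (simp add: field_simps)
  moreover have "real n + 1 - (real n + 1 - t) = t" by simp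
  ultimately show ?thesis
    unfolding psi_def half_psi_def by (simp only: mult.commute[of _ t] abs)
qed

text \<open>
  Monotonicity without derivatives: multiplication by the conjugate \<open>q u + q t\<close> turns the
  difference of the roots into \<open>(u - t) * (n + 1 - u - t)\<close>. The remaining factor is a sum of one
  term in \<open>u\<close> and one in \<open>t\<close>, each with the sign of the slope of \<open>half_psi n\<close> at that point.
\<close>

lemma half_psi_diff:
  fixes n :: nat and t u :: real
  defines "q \<equiv> \<lambda>t. sqrt (t * (real n + 1 - t))"
  assumes "0 \<le> t" "t \<le> real n + 1" "0 \<le> u" "u \<le> real n + 1"
  shows "(half_psi n u - half_psi n t) * (q u + q t) =
    2 / (real n + 1) * (u - t) *
      ((sqrt n * ((real n + 1) / 2 - u) - q u) + (sqrt n * ((real n + 1) / 2 - t) - q t))"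
proof -
  define h where "h = (real n + 1) / 2"
  have h: "real n + 1 - u - t = (h - u) + (h - t)"
    unfolding h_def by (simp add: field_simps)
  have q2: "q t * q t = t * (real n + 1 - t)" "q u * q u = u * (real n + 1 - u)"
    using assms by (simp_all add: q_def)
  have phi: "half_psi n x = 2 / (real n + 1) * (sqrt n * q x + (real n + 1) / 2 - x)" for x
    by (simp add: half_psi_def q_def divide_simps) (simp add: algebra_simps)
  have qq: "(q u - q t) * (q u + q t) = (u - t) * (real n + 1 - u - t)"
    using q2 by (simp add: algebra_simps)
  have "(half_psi n u - half_psi n t) * (q u + q t) =
    2 / (real n + 1) * (sqrt n * ((q u - q t) * (q u + q t)) - (u - t) * (q u + q t))"
    unfolding phi by (simp only: algebra_simps)
  also have "\<dots> = 2 / (real n + 1) * ((u - t) *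
      (sqrt n * ((h - u) + (h - t)) - (q u + q t)))"
    unfolding qq h by (simp add: algebra_simps)
  finally show ?thesis
    unfolding h_def[symmetric] by (simp only: algebra_simps)
qed

lemma half_psi_slope_sign:
  fixes n :: nat and t :: real
  assumes t: "0 \<le> t" "t \<le> real n + 1"
  shows "t \<le> (real n + 1) / 2 - sqrt (real n + 1) / 2 \<Longrightarrow>
           sqrt (t * (real n + 1 - t)) \<le> sqrt n * ((real n + 1) / 2 - t)"
    and "(real n + 1) / 2 - sqrt (real n + 1) / 2 \<le> t \<Longrightarrow>
           sqrt n * ((real n + 1) / 2 - t) \<le> sqrt (t * (real n + 1 - t))"
proof -
  define s where "s = (real n + 1) / 2 - t"
  have q: "t * (real n + 1 - t) = ((real n + 1) / 2)\<^sup>2 - s\<^sup>2"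
    by (simp add: s_def power2_eq_square field_simps)
  have h: "(sqrt (real n + 1) / 2)\<^sup>2 = (real n + 1) / 4"
    by (simp add: power_divide)
  (* Both claims compare n * s^2 with the radicand: the threshold is at s^2 = (n + 1) / 4. *)
  have key: "real n * s\<^sup>2 - t * (real n + 1 - t) = (real n + 1) * (s\<^sup>2 - (real n + 1) / 4)"
    unfolding q by (simp add: power2_eq_square field_simps)
  show "sqrt (t * (real n + 1 - t)) \<le> sqrt n * ((real n + 1) / 2 - t)"
    if "t \<le> (real n + 1) / 2 - sqrt (real n + 1) / 2"
  proof -
    have s: "sqrt (real n + 1) / 2 \<le> s" using that unfolding s_def by linarith
    have s0: "0 \<le> s" by (rule order_trans[OF _ s]) simp
    have "(real n + 1) / 4 \<le> s\<^sup>2"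
      using power_mono[OF s, of 2] h by simp
    then have "t * (real n + 1 - t) \<le> real n * s\<^sup>2"
      using key mult_nonneg_nonneg[of "real n + 1" "s\<^sup>2 - (real n + 1) / 4"] by linarith
    then have "sqrt (t * (real n + 1 - t)) \<le> sqrt (real n * s\<^sup>2)"
      by simp
    then show ?thesis using s0 by (simp add: real_sqrt_mult s_def)
  qed
  show "sqrt n * ((real n + 1) / 2 - t) \<le> sqrt (t * (real n + 1 - t))"
    if "(real n + 1) / 2 - sqrt (real n + 1) / 2 \<le> t"
  proof (cases "0 \<le> s")
    case True
    have s: "s \<le> sqrt (real n + 1) / 2" using that unfolding s_def by linarith
    have "s\<^sup>2 \<le> (real n + 1) / 4"
      using power_mono[OF s True, of 2] h by simp
    then have "real n * s\<^sup>2 \<le> t * (real n + 1 - t)"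
      using key mult_nonneg_nonpos[of "real n + 1" "s\<^sup>2 - (real n + 1) / 4"] by linarith
    then have "sqrt (real n * s\<^sup>2) \<le> sqrt (t * (real n + 1 - t))"
      by simp
    then show ?thesis using True by (simp add: real_sqrt_mult s_def)
  next
    case False
    then have "sqrt n * s \<le> 0" by (simp add: mult_nonneg_nonpos)
    also have "0 \<le> sqrt (t * (real n + 1 - t))" using t by simp
    finally show ?thesis by (simp add: s_def)
  qed
qed

lemma half_psi_mono:
  fixes n :: nat and t u :: real
  assumes "0 \<le> t" "t \<le> u" "u \<le> (real n + 1) / 2 - sqrt (real n + 1) / 2"
  shows "half_psi n t \<le> half_psi n u"
proof (cases "t = u")
  case False
  define q where "q = (\<lambda>t. sqrt (t * (real n + 1 - t)))"
  have "0 < sqrt (real n + 1)" by simp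
  then have u: "0 < u" using assms False by linarith
  have u': "u < real n + 1"
    using assms(3) \<open>0 < sqrt (real n + 1)\<close> unfolding add_divide_distrib by linarith
  then have pos: "0 < q u + q t"
    using assms u u' by (simp add: q_def add_pos_nonneg)
  have "0 \<le> 2 / (real n + 1) * (u - t) *
      ((sqrt n * ((real n + 1) / 2 - u) - q u) + (sqrt n * ((real n + 1) / 2 - t) - q t))"
    using half_psi_slope_sign(1)[of t n] half_psi_slope_sign(1)[of u n] assms u u'
    by (intro mult_nonneg_nonneg add_nonneg_nonneg) (simp_all add: q_def)
  then have "0 \<le> (half_psi n u - half_psi n t) * (q u + q t)"
    using half_psi_diff[of t n u] assms u u' by (simp add: q_def)
  then show ?thesis using pos by (simp add: zero_le_mult_iff)
qed simp

lemma half_psi_antimono: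
  fixes n :: nat and t u :: real
  assumes "0 < n" "(real n + 1) / 2 - sqrt (real n + 1) / 2 \<le> t" "t \<le> u" "u \<le> real n + 1"
  shows "half_psi n u \<le> half_psi n t"
proof (cases "t = u")
  case False
  define q where "q = (\<lambda>t. sqrt (t * (real n + 1 - t)))"
  have "sqrt (real n + 1) < real n + 1"
    using assms(1) by (intro real_less_lsqrt) (simp_all add: power2_eq_square)
  then have t: "0 < t" using assms(2) unfolding add_divide_distrib by linarith
  have t': "t < real n + 1" using assms(3,4) False by linarith
  then have pos: "0 < q u + q t"
    using assms t t' by (simp add: q_def add_nonneg_pos)
  have "2 / (real n + 1) * (u - t) *
      ((sqrt n * ((real n + 1) / 2 - u) - q u) + (sqrt n * ((real n + 1) / 2 - t) - q t)) \<le> 0"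
    using half_psi_slope_sign(2)[of t n] half_psi_slope_sign(2)[of u n] assms t t'
    by (intro mult_nonneg_nonpos add_nonpos_nonpos mult_nonneg_nonneg) (simp_all add: q_def)
  then have "(half_psi n u - half_psi n t) * (q u + q t) \<le> 0"
    using half_psi_diff[of t n u] assms t t' by (simp add: q_def)
  then show ?thesis using pos by (simp add: mult_le_0_iff)
qed simp

text \<open>
  Lagrange's identity \<open>(r * q + s)\<^sup>2 + (q - r * s)\<^sup>2 = (r\<^sup>2 + 1) * (q\<^sup>2 + s\<^sup>2)\<close> with \<open>r = sqrt n\<close>, where
  \<open>q\<^sup>2 + s\<^sup>2\<close> does not depend on \<open>t\<close>. The subtracted square is the defect in the Cauchy-Schwarz
  inequality, which settles the upper bound and its equality case together.
\<close>

lemma psi_square: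
  fixes n :: nat and t :: real
  assumes "0 \<le> t" "t \<le> real n + 1"
  shows "(psi n t)\<^sup>2 = (real n + 1) -
    (2 / (real n + 1) * (sqrt (t * (real n + 1 - t)) - sqrt n * \<bar>(real n + 1) / 2 - t\<bar>))\<^sup>2"
proof -
  define m where "m = real n + 1"
  define r where "r = sqrt n"
  define q where "q = sqrt (t * (m - t))"
  define s where "s = \<bar>m / 2 - t\<bar>"
  have m: "m > 0" by (simp add: m_def)
  have r2: "r\<^sup>2 = m - 1" by (simp add: r_def m_def)
  have qs: "q\<^sup>2 + s\<^sup>2 = m\<^sup>2 / 4"
    using assms by (simp add: q_def s_def m_def) (simp add: power2_eq_square field_simps)
  have "\<bar>1 - 2 * t / m\<bar> = 2 / m * s"
  proof -
    have "1 - 2 * t / m = 2 / m * (m / 2 - t)" using m by (simp add: field_simps)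
    then show ?thesis using m by (simp only: abs_mult s_def) simp
  qed
  then have psi: "psi n t = 2 / m * (r * q + s)"
    by (simp add: psi_def m_def q_def r_def algebra_simps)
  have "(r * q + s)\<^sup>2 + (q - r * s)\<^sup>2 = (r\<^sup>2 + 1) * (q\<^sup>2 + s\<^sup>2)"
    by (simp add: power2_eq_square algebra_simps)
  also have "\<dots> = m * (m\<^sup>2 / 4)" by (simp add: qs r2)
  finally have "(2 / m)\<^sup>2 * ((r * q + s)\<^sup>2 + (q - r * s)\<^sup>2) = (2 / m)\<^sup>2 * (m * (m\<^sup>2 / 4))"
    by simp
  also have "\<dots> = m" using m by (simp add: power2_eq_square)
  finally have "(psi n t)\<^sup>2 = m - (2 / m * (q - r * s))\<^sup>2"
    unfolding psi power_mult_distrib by (simp add: algebra_simps)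
  then show ?thesis by (simp add: m_def r_def q_def s_def)
qed

lemma psi_nonneg: "0 \<le> t \<Longrightarrow> t \<le> real n + 1 \<Longrightarrow> 0 \<le> psi n t"
  by (simp add: psi_def)

lemma psi_le_sqrt:
  assumes "0 \<le> t" "t \<le> real n + 1"
  shows "psi n t \<le> sqrt (real n + 1)"
  using psi_square[OF assms] by (intro real_le_rsqrt) simp

lemma psi_eq_sqrt_iff:
  assumes t: "0 \<le> t" "t \<le> real n + 1"
  shows "psi n t = sqrt (real n + 1) \<longleftrightarrow> \<bar>real n + 1 - 2 * t\<bar> = sqrt (real n + 1)"
proof -
  define s where "s = \<bar>(real n + 1) / 2 - t\<bar>"
  have q: "t * (real n + 1 - t) = ((real n + 1) / 2)\<^sup>2 - s\<^sup>2"
    by (simp add: s_def power2_eq_square field_simps)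
  have root: "x = sqrt y \<longleftrightarrow> x\<^sup>2 = y" if "0 \<le> x" "0 \<le> y" for x y :: real
    using that real_sqrt_unique[of x y] real_sqrt_pow2[of y] by metis
  have "psi n t = sqrt (real n + 1) \<longleftrightarrow> (psi n t)\<^sup>2 = real n + 1"
    using psi_nonneg[OF t] by (intro root) simp_all
  also have "\<dots> \<longleftrightarrow> sqrt (t * (real n + 1 - t)) = sqrt n * s"
  proof -
    have "real n + 1 - (2 / (real n + 1) * (x - y))\<^sup>2 = real n + 1 \<longleftrightarrow> x = y" for x y :: real
      by simp
    then show ?thesis unfolding psi_square[OF t] s_def .
  qed
  also have "sqrt n * s = sqrt (n * s\<^sup>2)"
    by (simp add: real_sqrt_mult s_def)
  also have "sqrt (t * (real n + 1 - t)) = sqrt (n * s\<^sup>2) \<longleftrightarrow> (real n + 1) * (2 * s)\<^sup>2 = (real n + 1) * (real n + 1)"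
  proof -
    have "(real n + 1) * (2 * s)\<^sup>2 - (real n + 1) * (real n + 1)
        = 4 * (n * s\<^sup>2 - t * (real n + 1 - t))"
      unfolding q by (simp add: power2_eq_square algebra_simps)
    moreover have "d = c \<longleftrightarrow> a = b" if "a - b = 4 * (c - d)" for a b c d :: real
      using that by auto
    ultimately show ?thesis unfolding real_sqrt_eq_iff by blast
  qed
  also have "\<dots> \<longleftrightarrow> (2 * s)\<^sup>2 = real n + 1" by simp
  also have "\<dots> \<longleftrightarrow> 2 * s = sqrt (real n + 1)"
    by (intro root[symmetric]) (simp_all add: s_def)
  also have "2 * s = \<bar>real n + 1 - 2 * t\<bar>"
  proof -
    have "2 * s = \<bar>2 * ((real n + 1) / 2 - t)\<bar>"
      unfolding s_def abs_mult by simp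
    also have "2 * ((real n + 1) / 2 - t) = real n + 1 - 2 * t"
      by (simp add: field_simps)
    finally show ?thesis .
  qed
  finally show ?thesis .
qed

lemma split_index_bounds:
  shows "0 \<le> split_index n" "split_index n + 1 \<le> int n + 1"
proof -
  have "sqrt (real n + 1) \<le> real n + 1"
    by (intro real_le_lsqrt) (simp_all add: power2_eq_square)
  then have "0 \<le> (real n + 1) / 2 - sqrt (real n + 1) / 2"
    by (simp add: field_simps)
  then show "0 \<le> split_index n"
    by (simp add: split_index_def)
  have "(real n + 1) / 2 - sqrt (real n + 1) / 2 < real n + 1"
    using real_sqrt_gt_zero[of "real n + 1"] unfolding add_divide_distrib by linarith
  then show "split_index n + 1 \<le> int n + 1"
    unfolding split_index_def by linarith
qed

text \<open>
  The split index and its successor enclose the maximum point of \<open>half_psi n\<close>, so every integer lies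
  on the far side of one of them. The argument covers \<open>k\<close> and \<open>n + 1 - k\<close> alike.
\<close>

lemma psi_le_max_split_index:
  fixes k :: nat
  assumes n: "0 < n" and k: "k \<le> n + 1"
  shows "psi n k \<le> max (psi n (of_int (split_index n))) (psi n (of_int (split_index n + 1)))"
proof -
  have half: "half_psi n k \<le> max (psi n (of_int (split_index n))) (psi n (of_int (split_index n + 1)))"
    if "k \<le> n + 1" for k :: nat
  proof (cases "int k \<le> split_index n")
    case True
    then have "real k \<le> of_int (split_index n)" by linarith
    moreover have "of_int (split_index n) \<le> (real n + 1) / 2 - sqrt (real n + 1) / 2"
      unfolding split_index_def by (rule of_int_floor_le)
    ultimately have "half_psi n k \<le> half_psi n (of_int (split_index n))"
      by (intro half_psi_mono) auto
    then show ?thesis unfolding psi_eq_max_half_psi by simp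
  next
    case False
    then have "of_int (split_index n + 1) \<le> real k" by linarith
    moreover have "(real n + 1) / 2 - sqrt (real n + 1) / 2 \<le> of_int (split_index n + 1)"
      unfolding split_index_def by linarith
    ultimately have "half_psi n k \<le> half_psi n (of_int (split_index n + 1))"
      using n that by (intro half_psi_antimono) auto
    then show ?thesis unfolding psi_eq_max_half_psi by simp
  qed
  have "real (n + 1 - k) = real n + 1 - real k" using k by simp
  then show ?thesis
    using half[OF k] half[of "n + 1 - k"] by (simp add: psi_eq_max_half_psi[of n "real k"])
qed

text \<open>
  Near the midpoint \<open>(n + 1) / 2\<close>, where \<open>psi\<close> equals \<open>sqrt n\<close>, the absolute value grows linearly in
  the distance \<open>s\<close> while the root loses only a quadratic amount; the bound on \<open>sqrt n * s\<close> says
  that \<open>s\<close> is small enough for the linear gain to win.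
\<close>

lemma psi_gt_sqrt:
  fixes s :: real
  assumes s: "0 < s" "s < (real n + 1) / 2" and sn: "sqrt n * s \<le> (real n + 1) / 2"
  shows "sqrt n < psi n ((real n + 1) / 2 - s)"
proof -
  define m where "m = real n + 1"
  define q where "q = sqrt ((m / 2)\<^sup>2 - s\<^sup>2)"
  have m: "m > 0" by (simp add: m_def)
  have "s\<^sup>2 < (m / 2)\<^sup>2" using s unfolding m_def by (intro power_strict_mono) auto
  then have q: "0 < q" and q2: "q\<^sup>2 = (m / 2)\<^sup>2 - s\<^sup>2" by (simp_all add: q_def)
  have "(sqrt n * q + s - sqrt n * (m / 2)) * (m / 2 + q)
        = s * (m / 2 + q) - sqrt n * ((m / 2)\<^sup>2 - q\<^sup>2)"
    by (simp add: power2_eq_square algebra_simps)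
  also have "\<dots> = s * (m / 2 + q - sqrt n * s)"
    unfolding q2 by (simp add: power2_eq_square algebra_simps)
  also have "\<dots> > 0"
  proof (intro mult_pos_pos)
    show "0 < m / 2 + q - sqrt n * s" using q sn unfolding m_def by linarith
  qed (fact s(1))
  finally have less: "sqrt n * (m / 2) < sqrt n * q + s"
    using q m by (simp add: zero_less_mult_iff)
  have "(m / 2 - s) * (m - (m / 2 - s)) = (m / 2)\<^sup>2 - s\<^sup>2"
    by (simp add: power2_eq_square field_simps)
  then have "psi n (m / 2 - s) = 2 / m * (sqrt n * q) + \<bar>1 - 2 * (m / 2 - s) / m\<bar>"
    by (simp add: psi_def q_def m_def)
  also have "1 - 2 * (m / 2 - s) / m = 2 / m * s" using m by (simp add: field_simps)
  also have "2 / m * (sqrt n * q) + \<bar>2 / m * s\<bar> = 2 / m * (sqrt n * q + s)"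
    using m s by (simp add: algebra_simps)
  also have "\<dots> > 2 / m * (sqrt n * (m / 2))"
    using less m by (intro mult_strict_left_mono) auto
  also have "2 / m * (sqrt n * (m / 2)) = sqrt n" using m by simp
  finally show ?thesis by (simp add: m_def)
qed

lemma ex_psi_gt_sqrt:
  assumes "2 \<le> n"
  shows "\<exists>k \<le> n + 1. sqrt n < psi n (real k)"
proof -
  (* The midpoint (n + 1) / 2 is an integer for odd n, so there the closest other one is at
     distance 1; for even n an integer at distance 1/2 exists. *)
  have "0 \<le> (sqrt n - 1)\<^sup>2" by simp
  then have amgm: "sqrt n \<le> (real n + 1) / 2" by (simp add: power2_diff)
  show ?thesis
  proof (cases "even n")
    case True
    then obtain j where j: "n = 2 * j" by auto
    have "sqrt n < psi n ((real n + 1) / 2 - 1 / 2)"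
      using assms amgm by (intro psi_gt_sqrt) auto
    moreover have "(real n + 1) / 2 - 1 / 2 = real j" using j by (simp add: field_simps)
    ultimately show ?thesis using j by (intro exI[of _ j]) auto
  next
    case False
    then obtain j where j: "n = 2 * j + 1" by (auto elim: oddE)
    have "sqrt n < psi n ((real n + 1) / 2 - 1)"
      using assms amgm j by (intro psi_gt_sqrt) auto
    moreover have "(real n + 1) / 2 - 1 = real j" using j by (simp add: field_simps)
    ultimately show ?thesis using j by (intro exI[of _ j]) auto
  qed
qed

lemma psi_split_index_eq_sqrt:
  assumes n: "0 < n" and int: "sqrt (real n + 1) \<in> \<int>"
  shows "psi n (of_int (split_index n)) = sqrt (real n + 1)"
proof -
  from int obtain r where r: "sqrt (real n + 1) = of_int r" by (auto elim: Ints_cases)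
  have r0: "0 \<le> r" using r by (metis of_int_0_le_iff real_sqrt_ge_zero of_nat_0_le_iff add_nonneg_nonneg zero_le_one)
  have "(of_int r)\<^sup>2 = real n + 1" using r by (metis real_sqrt_pow2 of_nat_0_le_iff add_nonneg_nonneg zero_le_one)
  then have m: "real n + 1 = of_int (r * r)" by (simp add: power2_eq_square)
  (* Parity makes the maximum point (r^2 - r) / 2 of half_psi n an integer. *)
  have "even (r * r - r)" by simp
  then obtain a where a: "r * r - r = 2 * a" by (rule evenE)
  then have "(real n + 1) / 2 - sqrt (real n + 1) / 2 = of_int a"
    unfolding m unfolding r[unfolded m] by (simp flip: diff_divide_distrib of_int_mult of_int_diff)
  then have si: "split_index n = a" by (simp add: split_index_def)
  have t: "real n + 1 - 2 * of_int a = of_int r"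
    using \<open>_ = of_int a\<close> unfolding r by (simp add: field_simps)
  have "real_of_int a \<le> real n + 1" "0 \<le> real_of_int a"
    using split_index_bounds[of n] unfolding si by linarith+
  moreover have "\<bar>real n + 1 - 2 * of_int a\<bar> = sqrt (real n + 1)"
    unfolding t r using r0 by simp
  ultimately show ?thesis
    unfolding si by (intro psi_eq_sqrt_iff[THEN iffD2])
qed

section \<open>Barycentric coordinates of an inscribed regular simplex\<close>

locale inscribed_regular_simplex =
  fixes V :: "'a::euclidean_space set" and x0 :: 'a and R l :: real
  assumes R_pos: "R > 0"
    and independent: "\<not> affine_dependent V"
    and card_V: "card V = DIM('a) + 1"
    and on_sphere: "V \<subseteq> sphere x0 R"
    and equal_dist: "\<And>v w. v \<in> V \<Longrightarrow> w \<in> V \<Longrightarrow> v \<noteq> w \<Longrightarrow> dist v w = l"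
begin

text \<open>
  The barycentric coordinate of \<open>x\<close> that belongs to \<open>v\<close>. That this formula does give the
  barycentric coordinates is shown in \<open>bary_coordinates\<close>.
\<close>

definition bary :: "'a \<Rightarrow> 'a \<Rightarrow> real" where
  "bary v x = 1 / (real DIM('a) + 1)
    + real DIM('a) / ((real DIM('a) + 1) * R\<^sup>2) * ((v - x0) \<bullet> (x - x0))"

lemma finite_V: "finite V"
  using card_V card.infinite by fastforce

lemma affine_hull_V: "affine hull V = UNIV"
  using independent card_V by (intro affine_independent_span_eq) simp_all

lemma inner_self: "v \<in> V \<Longrightarrow> (v - x0) \<bullet> (v - x0) = R\<^sup>2"
  using on_sphere by (auto simp: dot_square_norm dist_norm norm_minus_commute)

lemma inner_distinct:
  assumes "v \<in> V" "w \<in> V" "v \<noteq> w"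
  shows "(v - x0) \<bullet> (w - x0) = R\<^sup>2 - l\<^sup>2 / 2"
proof -
  have expand: "(a - b) \<bullet> (a - b) = a \<bullet> a + b \<bullet> b - 2 * (a \<bullet> b)" for a b :: 'a
    by (simp add: inner_diff_left inner_diff_right inner_commute)
  have "l\<^sup>2 = ((v - x0) - (w - x0)) \<bullet> ((v - x0) - (w - x0))"
    using equal_dist[OF assms] by (simp add: dist_norm dot_square_norm)
  also have "\<dots> = (v - x0) \<bullet> (v - x0) + (w - x0) \<bullet> (w - x0) - 2 * ((v - x0) \<bullet> (w - x0))"
    by (rule expand)
  finally show ?thesis
    using inner_self[OF assms(1)] inner_self[OF assms(2)] by (simp add: field_simps)
qed

lemma inner_vertex_sum:
  assumes "w \<in> V"
  shows "(\<Sum>v\<in>V. v - x0) \<bullet> (w - x0) = R\<^sup>2 + real DIM('a) * (R\<^sup>2 - l\<^sup>2 / 2)"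
proof -
  have "(\<Sum>v\<in>V. v - x0) \<bullet> (w - x0) = (\<Sum>v\<in>V. (v - x0) \<bullet> (w - x0))"
    by (rule inner_sum_left)
  also have "\<dots> = (w - x0) \<bullet> (w - x0) + (\<Sum>v\<in>V - {w}. (v - x0) \<bullet> (w - x0))"
    using finite_V assms by (rule sum.remove)
  also have "(\<Sum>v\<in>V - {w}. (v - x0) \<bullet> (w - x0)) = (\<Sum>v\<in>V - {w}. R\<^sup>2 - l\<^sup>2 / 2)"
    using assms by (intro sum.cong inner_distinct) auto
  finally show ?thesis
    using assms finite_V card_V inner_self by simp
qed

text \<open>
  The inner product with \<open>\<Sum>v\<in>V. v - x0\<close> is constant on the vertices, hence on their affine hull,
  which is the whole space. Only the zero vector has a constant inner product with everything.
\<close>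

lemma sum_vertices: "(\<Sum>v\<in>V. v - x0) = 0"
proof -
  define s where "s = (\<Sum>v\<in>V. v - x0)"
  define c where "c = R\<^sup>2 + real DIM('a) * (R\<^sup>2 - l\<^sup>2 / 2) + s \<bullet> x0"
  have "V \<subseteq> {x. s \<bullet> x = c}"
    using inner_vertex_sum by (auto simp: s_def c_def inner_diff_right diff_eq_eq)
  then have "affine hull V \<subseteq> {x. s \<bullet> x = c}"
    by (intro hull_minimal affine_hyperplane)
  then have "s \<bullet> s = c" "s \<bullet> 0 = c"
    unfolding affine_hull_V by blast+
  then show ?thesis
    by (simp add: s_def)
qed

lemma inner_distinct_eq:
  assumes "v \<in> V" "w \<in> V" "v \<noteq> w"
  shows "(v - x0) \<bullet> (w - x0) = - R\<^sup>2 / real DIM('a)"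
proof -
  have "R\<^sup>2 + real DIM('a) * ((v - x0) \<bullet> (w - x0)) = 0"
    using inner_vertex_sum[OF assms(1)] inner_distinct[OF assms] by (simp add: sum_vertices)
  then have "real DIM('a) * ((v - x0) \<bullet> (w - x0)) = - R\<^sup>2"
    by linarith
  then show ?thesis
    by (metis DIM_positive less_numeral_extra(3) nonzero_mult_div_cancel_left of_nat_eq_0_iff)
qed

lemma bary_vertex:
  assumes "v \<in> V" "w \<in> V"
  shows "bary v w = (if v = w then 1 else 0)"
  using assms R_pos
  by (auto simp: bary_def inner_self inner_distinct_eq divide_simps) (simp_all add: algebra_simps)

lemma bary_affine:
  assumes "sum c I = 1"
  shows "bary v (\<Sum>i\<in>I. c i *\<^sub>R x i) = (\<Sum>i\<in>I. c i * bary v (x i))"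
proof -
  have "(\<Sum>i\<in>I. c i *\<^sub>R x i) - x0 = (\<Sum>i\<in>I. c i *\<^sub>R (x i - x0))"
    using assms by (simp add: scaleR_diff_right sum_subtractf flip: scaleR_left.sum)
  moreover have "(\<Sum>i\<in>I. c i * a) = a" for a :: real
    using assms by (simp flip: sum_distrib_right)
  moreover have "(\<Sum>i\<in>I. c i * (a * b i)) = a * (\<Sum>i\<in>I. c i * b i)" for a :: real and b
    by (simp add: sum_distrib_left mult.left_commute)
  ultimately show ?thesis
    by (simp only: bary_def inner_sum_right inner_scaleR_right distrib_left sum.distrib)
qed

text \<open>
  Any affine representation of \<open>x\<close> by the vertices has coefficients \<open>bary v x\<close>, because
  \<open>bary v\<close> is affine and takes the value \<open>1\<close> at \<open>v\<close> and \<open>0\<close> at the other vertices.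
\<close>

lemma bary_coordinates:
  shows sum_bary: "(\<Sum>v\<in>V. bary v x) = 1"
    and bary_combination: "(\<Sum>v\<in>V. bary v x *\<^sub>R v) = x"
proof -
  have "x \<in> affine hull V" by (simp add: affine_hull_V)
  then obtain c where c: "sum c V = 1" "(\<Sum>v\<in>V. c v *\<^sub>R v) = x"
    unfolding affine_hull_finite[OF finite_V] by blast
  have "bary w x = c w" if "w \<in> V" for w
  proof -
    have "bary w x = (\<Sum>v\<in>V. c v * bary w v)"
      using bary_affine[OF c(1), of w "\<lambda>v. v"] c(2) by simp
    also have "\<dots> = (\<Sum>v\<in>V. if v = w then c v else 0)"
      using that by (intro sum.cong) (auto simp: bary_vertex)
    finally show ?thesis using that finite_V by simp
  qed
  then show "(\<Sum>v\<in>V. bary v x) = 1" "(\<Sum>v\<in>V. bary v x *\<^sub>R v) = x"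
    using c by simp_all
qed

text \<open>
  Expanding the square, each of the \<open>card A\<close> rows of the Gram matrix contributes one diagonal entry
  \<open>R\<^sup>2\<close> and \<open>card A - 1\<close> entries \<open>- R\<^sup>2 / n\<close>.
\<close>

lemma norm_sum_subset:
  assumes A: "A \<subseteq> V"
  shows "norm (\<Sum>v\<in>A. v - x0)
    = R / sqrt (real DIM('a)) * sqrt (real (card A) * (real DIM('a) + 1 - real (card A)))"
proof -
  have fin: "finite A" using A finite_V finite_subset by blast
  have le: "card A \<le> DIM('a) + 1" using card_mono[OF finite_V A] card_V by simp
  have row: "(\<Sum>w\<in>A. (v - x0) \<bullet> (w - x0)) = R\<^sup>2 / real DIM('a) * (real DIM('a) + 1 - real (card A))"
    if v: "v \<in> A" for v
  proof -
    have "(\<Sum>w\<in>A. (v - x0) \<bullet> (w - x0))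
        = (v - x0) \<bullet> (v - x0) + (\<Sum>w\<in>A - {v}. (v - x0) \<bullet> (w - x0))"
      using fin v by (rule sum.remove)
    also have "(\<Sum>w\<in>A - {v}. (v - x0) \<bullet> (w - x0)) = (\<Sum>w\<in>A - {v}. - R\<^sup>2 / real DIM('a))"
      using A v by (intro sum.cong inner_distinct_eq) auto
    also have "\<dots> = (real (card A) - 1) * (- R\<^sup>2 / real DIM('a))"
      using v fin by (simp add: of_nat_diff Suc_leI card_gt_0_iff)
        (metis Suc_leI card_gt_0_iff empty_iff of_nat_1 of_nat_diff One_nat_def)
    finally show ?thesis
      using A v inner_self[of v] by (auto simp: field_simps)
  qed
  have "(norm (\<Sum>v\<in>A. v - x0))\<^sup>2 = (\<Sum>v\<in>A. \<Sum>w\<in>A. (v - x0) \<bullet> (w - x0))"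
    unfolding power2_norm_eq_inner inner_sum_left by (simp only: inner_sum_right)
  also have "\<dots> = (R / sqrt (real DIM('a)) * sqrt (real (card A) * (real DIM('a) + 1 - real (card A))))\<^sup>2"
    using row le by (simp add: power_mult_distrib power_divide)
  finally show ?thesis
    using R_pos le by (simp add: power2_eq_iff_nonneg)
qed

lemma sum_bary_subset:
  "(\<Sum>v\<in>A. bary v x) = real (card A) / (real DIM('a) + 1)
    + real DIM('a) / ((real DIM('a) + 1) * R\<^sup>2) * ((\<Sum>v\<in>A. v - x0) \<bullet> (x - x0))"
  by (simp add: bary_def sum.distrib inner_sum_left sum_distrib_left)

text \<open>
  The right-hand side is the maximum over the ball of \<open>1 - 2 * (\<Sum>v\<in>A. bary v x)\<close>, the signed sum of
  the coordinates with minus signs on \<open>A\<close>.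
\<close>

lemma half_psi_eq_norm_sum:
  assumes "A \<subseteq> V"
  shows "half_psi DIM('a) (real (card A)) = 1 - 2 * (card A / (real DIM('a) + 1))
    + 2 * (real DIM('a) / ((real DIM('a) + 1) * R)) * norm (\<Sum>v\<in>A. v - x0)"
proof -
  have "2 * (real DIM('a) / ((real DIM('a) + 1) * R)) * (R / sqrt (real DIM('a)))
    = 2 * (real DIM('a) / sqrt (real DIM('a))) / (real DIM('a) + 1)"
    using R_pos by simp
  also have "real DIM('a) / sqrt (real DIM('a)) = sqrt (real DIM('a))"
    by (rule real_div_sqrt) simp
  finally have "2 * (real DIM('a) / ((real DIM('a) + 1) * R)) * (R / sqrt (real DIM('a)))
    = 2 * sqrt (real DIM('a)) / (real DIM('a) + 1)" .
  then show ?thesis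
    unfolding norm_sum_subset[OF assms] half_psi_def mult.assoc[symmetric] by simp
qed

section \<open>The maximum of the Lebesgue function\<close>

text \<open>
  The witness is the point of the sphere opposite to \<open>s = (\<Sum>v\<in>A. v - x0)\<close> for any \<open>k\<close>-element set
  \<open>A\<close> of vertices; it minimizes \<open>\<Sum>v\<in>A. bary v x\<close> over the ball. If \<open>s = 0\<close>, then \<open>sgn s = 0\<close> and the
  witness is the centre, which serves equally well because that sum is then constant.
\<close>

lemma half_psi_le_lebesgue:
  assumes "k \<le> DIM('a) + 1"
  shows "\<exists>x\<in>cball x0 R. half_psi DIM('a) (real k) \<le> (\<Sum>v\<in>V. \<bar>bary v x\<bar>)"
proof -
  obtain A where A: "A \<subseteq> V" "card A = k"
    using obtain_subset_with_card_n[of k V] assms card_V by auto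
  define s where "s = (\<Sum>v\<in>A. v - x0)"
  define x where "x = x0 - R *\<^sub>R sgn s"
  have x: "x \<in> cball x0 R"
    using R_pos by (simp add: x_def dist_norm norm_sgn)
  have "s \<bullet> sgn s = norm s"
    by (cases "s = 0") (simp_all add: sgn_div_norm dot_square_norm power2_eq_square)
  then have sx: "s \<bullet> (x - x0) = - R * norm s"
    by (simp add: x_def)
  have "half_psi DIM('a) (real k) = 1 - 2 * (\<Sum>v\<in>A. bary v x)"
    unfolding sum_bary_subset s_def[symmetric] sx half_psi_eq_norm_sum[OF A(1)] A(2)[symmetric]
    using R_pos by (simp add: power2_eq_square distrib_left mult.assoc)
  also have "\<dots> = (\<Sum>v\<in>V - A. bary v x) - (\<Sum>v\<in>A. bary v x)"
    using sum.subset_diff[OF A(1) finite_V, of "\<lambda>v. bary v x"] sum_bary[of x] by simp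
  also have "\<dots> \<le> (\<Sum>v\<in>V - A. \<bar>bary v x\<bar>) + (\<Sum>v\<in>A. \<bar>bary v x\<bar>)"
  proof -
    have "(\<Sum>v\<in>V - A. bary v x) \<le> (\<Sum>v\<in>V - A. \<bar>bary v x\<bar>)"
      by (intro sum_mono) simp
    moreover have "- (\<Sum>v\<in>A. bary v x) \<le> (\<Sum>v\<in>A. \<bar>bary v x\<bar>)"
      unfolding sum_negf[symmetric] by (intro sum_mono) simp
    ultimately show ?thesis by linarith
  qed
  also have "\<dots> = (\<Sum>v\<in>V. \<bar>bary v x\<bar>)"
    using sum.subset_diff[OF A(1) finite_V, of "\<lambda>v. \<bar>bary v x\<bar>"] by simp
  finally show ?thesis using x by blast
qed

text \<open>
  Here \<open>k\<close> counts the negative coordinates of \<open>x\<close>. With their signs the sum of absolute values is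
  linear in \<open>x\<close>, so the Cauchy-Schwarz inequality bounds it by the value at the opposite point.
\<close>

lemma lebesgue_le_half_psi:
  assumes x: "x \<in> cball x0 R"
  shows "\<exists>k\<le>DIM('a) + 1. (\<Sum>v\<in>V. \<bar>bary v x\<bar>) \<le> half_psi DIM('a) (real k)"
proof -
  define A where "A = {v \<in> V. bary v x < 0}"
  have A: "A \<subseteq> V" by (auto simp: A_def)
  define s where "s = (\<Sum>v\<in>A. v - x0)"
  have "norm (x - x0) \<le> R"
    using x by (simp add: dist_norm norm_minus_commute)
  then have "norm s * norm (x - x0) \<le> norm s * R"
    by (intro mult_left_mono) auto
  then have sx: "- (s \<bullet> (x - x0)) \<le> norm s * R"
    using Cauchy_Schwarz_ineq2[of s "x - x0"] by linarith
  have "(\<Sum>v\<in>V. \<bar>bary v x\<bar>) = (\<Sum>v\<in>V - A. \<bar>bary v x\<bar>) + (\<Sum>v\<in>A. \<bar>bary v x\<bar>)"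
    using sum.subset_diff[OF A finite_V, of "\<lambda>v. \<bar>bary v x\<bar>"] by simp
  also have "(\<Sum>v\<in>V - A. \<bar>bary v x\<bar>) = (\<Sum>v\<in>V - A. bary v x)"
    by (intro sum.cong) (auto simp: A_def)
  also have "(\<Sum>v\<in>A. \<bar>bary v x\<bar>) = - (\<Sum>v\<in>A. bary v x)"
    unfolding sum_negf[symmetric] by (intro sum.cong) (auto simp: A_def)
  also have "(\<Sum>v\<in>V - A. bary v x) + - (\<Sum>v\<in>A. bary v x) = 1 - 2 * (\<Sum>v\<in>A. bary v x)"
    using sum.subset_diff[OF A finite_V, of "\<lambda>v. bary v x"] sum_bary[of x] by simp
  also have "\<dots> = 1 - 2 * (card A / (real DIM('a) + 1))
      + 2 * (real DIM('a) / ((real DIM('a) + 1) * R\<^sup>2)) * (- (s \<bullet> (x - x0)))"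
    unfolding sum_bary_subset s_def[symmetric] by (simp only: distrib_left mult_minus_right mult.assoc)
  also have "\<dots> \<le> 1 - 2 * (card A / (real DIM('a) + 1))
      + 2 * (real DIM('a) / ((real DIM('a) + 1) * R\<^sup>2)) * (norm s * R)"
    using sx by (intro add_left_mono mult_left_mono) auto
  also have "\<dots> = half_psi DIM('a) (card A)"
    unfolding half_psi_eq_norm_sum[OF A] s_def[symmetric]
    using R_pos by (simp add: power2_eq_square)
  finally show ?thesis
    using card_mono[OF finite_V A] card_V by auto
qed

end

section \<open>The norm of the interpolation projector\<close>

lemma abs_le_sup_norm:
  assumes "compact B" "continuous_on B f" "x \<in> B"
  shows "\<bar>f x\<bar> \<le> sup_norm B f"
proof -
  have "compact ((\<lambda>x. \<bar>f x\<bar>) ` B)"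
    using assms by (intro compact_continuous_image continuous_intros)
  then have "bdd_above ((\<lambda>x. \<bar>f x\<bar>) ` B)"
    by (intro bounded_imp_bdd_above compact_imp_bounded)
  then show ?thesis
    unfolding sup_norm_def using assms(3) by (intro cSUP_upper)
qed

lemma poly_deg_le_1_affine:
  assumes "p \<in> polys_deg_le_1" "sum c I = 1"
  shows "p (\<Sum>i\<in>I. c i *\<^sub>R x i) = (\<Sum>i\<in>I. c i * p (x i))"
proof -
  obtain a b where p: "\<And>y. p y = a + (\<Sum>j\<in>UNIV. b j * y $ j)"
    using assms(1) unfolding polys_deg_le_1_def by blast
  have "(\<Sum>i\<in>I. c i * p (x i)) = (\<Sum>i\<in>I. c i * a) + (\<Sum>i\<in>I. \<Sum>j\<in>UNIV. c i * (b j * x i $ j))"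
    by (simp add: p distrib_left sum.distrib sum_distrib_left)
  also have "(\<Sum>i\<in>I. c i * a) = a"
    using assms(2) by (simp flip: sum_distrib_right)
  also have "(\<Sum>i\<in>I. \<Sum>j\<in>UNIV. c i * (b j * x i $ j)) = (\<Sum>j\<in>UNIV. \<Sum>i\<in>I. b j * (c i * x i $ j))"
    by (subst sum.swap) (simp add: mult.left_commute)
  finally show ?thesis
    by (simp add: p sum_distrib_left)
qed

locale simplex_interpolation = inscribed_regular_simplex V x0 R l
  for V :: "(real ^ 'n) set" and x0 R l +
  fixes P :: "(real ^ 'n \<Rightarrow> real) \<Rightarrow> (real ^ 'n \<Rightarrow> real)"
  assumes projector: "interpolation_projector (cball x0 R) V P"
begin

lemma nodes_in_ball: "V \<subseteq> cball x0 R"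
  using projector by (simp add: interpolation_projector_def)

text \<open>
  A polynomial of degree at most one commutes with affine combinations, so its values at the
  vertices determine it through the barycentric coordinates.
\<close>

lemma lagrange_formula:
  assumes "continuous_on (cball x0 R) f"
  shows "P f x = (\<Sum>v\<in>V. bary v x * f v)"
proof -
  have Pf: "P f \<in> polys_deg_le_1" "\<And>v. v \<in> V \<Longrightarrow> P f v = f v"
    using projector assms by (auto simp: interpolation_projector_def cont_fun_space_def)
  have "P f x = (\<Sum>v\<in>V. bary v x * P f v)"
    using poly_deg_le_1_affine[OF Pf(1) sum_bary, of x "\<lambda>v. v"]
    by (simp add: bary_combination)
  then show ?thesis
    using Pf(2) by simp
qed

lemma continuous_on_projection:
  assumes "continuous_on (cball x0 R) f"
  shows "continuous_on (cball x0 R) (P f)"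
proof -
  have "continuous_on (cball x0 R) (\<lambda>x. \<Sum>v\<in>V. bary v x * f v)"
    unfolding bary_def by (intro continuous_intros)
  then show ?thesis
    using lagrange_formula[OF assms] by (simp cong: continuous_on_cong)
qed

lemma sup_norm_projection_le:
  assumes M: "\<And>x. x \<in> cball x0 R \<Longrightarrow> (\<Sum>v\<in>V. \<bar>bary v x\<bar>) \<le> M"
    and f: "continuous_on (cball x0 R) f" "sup_norm (cball x0 R) f \<le> 1"
  shows "sup_norm (cball x0 R) (P f) \<le> M"
  unfolding sup_norm_def
proof (rule cSUP_least)
  show "cball x0 R \<noteq> {}" using R_pos by simp
  fix x assume x: "x \<in> cball x0 R"
  have "\<bar>P f x\<bar> \<le> (\<Sum>v\<in>V. \<bar>bary v x * f v\<bar>)"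
    unfolding lagrange_formula[OF f(1)] by (rule sum_abs)
  also have "\<dots> \<le> (\<Sum>v\<in>V. \<bar>bary v x\<bar>)"
  proof (rule sum_mono)
    fix v assume "v \<in> V"
    then have "\<bar>f v\<bar> \<le> 1"
      using abs_le_sup_norm[OF compact_cball f(1), of v] nodes_in_ball f(2) by auto
    then show "\<bar>bary v x * f v\<bar> \<le> \<bar>bary v x\<bar>"
      unfolding abs_mult by (intro mult_right_le_one_le) auto
  qed
  also have "\<dots> \<le> M" by (rule M[OF x])
  finally show "\<bar>P f x\<bar> \<le> M" .
qed

lemma operator_norm_le:
  assumes "\<And>x. x \<in> cball x0 R \<Longrightarrow> (\<Sum>v\<in>V. \<bar>bary v x\<bar>) \<le> M"
  shows "operator_norm (cball x0 R) P \<le> M"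
  unfolding operator_norm_def
proof (rule cSUP_least)
  have "(\<lambda>_. 0) \<in> {f \<in> cont_fun_space (cball x0 R). sup_norm (cball x0 R) f \<le> 1}"
    using R_pos by (simp add: cont_fun_space_def sup_norm_def)
  then show "{f \<in> cont_fun_space (cball x0 R). sup_norm (cball x0 R) f \<le> 1} \<noteq> {}"
    by blast
qed (use sup_norm_projection_le[OF assms] in \<open>auto simp: cont_fun_space_def\<close>)

text \<open>
  A function of norm at most one whose values at the nodes are the signs of the coordinates of \<open>x\<close>
  is mapped by \<open>P\<close> to a function whose value at \<open>x\<close> is the Lebesgue function. Tietze's theorem
  extends the prescribed values from the finite set of nodes. The bound \<open>M\<close> makes the supremum that
  defines the operator norm one of a bounded set.
\<close>

lemma lebesgue_le_operator_norm:
  assumes M: "\<And>x. x \<in> cball x0 R \<Longrightarrow> (\<Sum>v\<in>V. \<bar>bary v x\<bar>) \<le> M"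
    and x: "x \<in> cball x0 R"
  shows "(\<Sum>v\<in>V. \<bar>bary v x\<bar>) \<le> operator_norm (cball x0 R) P"
proof -
  have "continuous_on V (\<lambda>v. sgn (bary v x))"
    by (rule continuous_on_finite[OF finite_V])
  moreover have "closedin (top_of_set UNIV) V"
    using finite_imp_closed[OF finite_V] by simp
  ultimately obtain g where g: "continuous_on UNIV g" "\<And>v. v \<in> V \<Longrightarrow> g v = sgn (bary v x)"
    "\<And>y. norm (g y) \<le> 1"
    by (rule Tietze[where B = 1]) (auto simp: sgn_real_def)
  have cont: "continuous_on (cball x0 R) g"
    using g(1) by (rule continuous_on_subset) simp
  have unit: "sup_norm (cball x0 R) g \<le> 1"
    unfolding sup_norm_def using R_pos g(3) by (intro cSUP_least) auto
  have "(\<Sum>v\<in>V. \<bar>bary v x\<bar>) = P g x"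
    unfolding lagrange_formula[OF cont] using g(2)
    by (intro sum.cong) (auto simp: abs_sgn)
  also have "\<dots> \<le> sup_norm (cball x0 R) (P g)"
    using abs_le_sup_norm[OF compact_cball continuous_on_projection[OF cont] x] by linarith
  also have "\<dots> \<le> operator_norm (cball x0 R) P"
    unfolding operator_norm_def
  proof (rule cSUP_upper)
    show "bdd_above ((\<lambda>f. sup_norm (cball x0 R) (P f))
        ` {f \<in> cont_fun_space (cball x0 R). sup_norm (cball x0 R) f \<le> 1})"
      using sup_norm_projection_le[OF M] by (intro bdd_aboveI2) (auto simp: cont_fun_space_def)
  qed (use cont unit in \<open>simp add: cont_fun_space_def\<close>)
  finally show ?thesis .
qed

lemma psi_le_operator_norm:
  assumes k: "k \<le> CARD('n) + 1"
  shows "psi CARD('n) (real k) \<le> operator_norm (cball x0 R) P"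
proof -
  have half: "half_psi CARD('n) (real j) \<le> operator_norm (cball x0 R) P" if j: "j \<le> CARD('n) + 1" for j
  proof -
    have M: "(\<Sum>v\<in>V. \<bar>bary v x\<bar>) \<le> sqrt (real CARD('n) + 1)" if x: "x \<in> cball x0 R" for x
    proof -
      obtain i where i: "i \<le> CARD('n) + 1" "(\<Sum>v\<in>V. \<bar>bary v x\<bar>) \<le> half_psi CARD('n) (real i)"
        using lebesgue_le_half_psi[OF x] by auto
      then show ?thesis
        using psi_le_sqrt[of "real i" "CARD('n)"] by (simp add: psi_eq_max_half_psi)
    qed
    obtain x where "x \<in> cball x0 R" "half_psi CARD('n) (real j) \<le> (\<Sum>v\<in>V. \<bar>bary v x\<bar>)"
      using half_psi_le_lebesgue[of j] j by auto
    then show ?thesis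
      using lebesgue_le_operator_norm[OF M] by force
  qed
  have "real (CARD('n) + 1 - k) = real CARD('n) + 1 - real k" using k by simp
  then show ?thesis
    using half[OF k] half[of "CARD('n) + 1 - k"] by (simp add: psi_eq_max_half_psi)
qed

lemma operator_norm_eq_max_psi:
  shows "operator_norm (cball x0 R) P =
    max (psi CARD('n) (of_int (split_index CARD('n))))
        (psi CARD('n) (of_int (split_index CARD('n) + 1)))" (is "?N = max ?a ?b")
proof (rule antisym)
  show "?N \<le> max ?a ?b"
  proof (rule operator_norm_le)
    fix x assume "x \<in> cball x0 R"
    then obtain k where k: "k \<le> CARD('n) + 1" "(\<Sum>v\<in>V. \<bar>bary v x\<bar>) \<le> half_psi CARD('n) (real k)"
      using lebesgue_le_half_psi by auto
    then have "(\<Sum>v\<in>V. \<bar>bary v x\<bar>) \<le> psi CARD('n) (real k)"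
      by (simp add: psi_eq_max_half_psi)
    also have "\<dots> \<le> max ?a ?b"
      using k(1) by (intro psi_le_max_split_index) simp_all
    finally show "(\<Sum>v\<in>V. \<bar>bary v x\<bar>) \<le> max ?a ?b" .
  qed
  define a where "a = nat (split_index CARD('n))"
  have a: "split_index CARD('n) = int a" "a + 1 \<le> CARD('n) + 1"
    using split_index_bounds[of "CARD('n)"] by (simp_all add: a_def)
  show "max ?a ?b \<le> ?N"
    using psi_le_operator_norm[of a] psi_le_operator_norm[of "a + 1"] a(2)
    unfolding a(1) by (simp add: add.commute)
qed

end

text \<open>
  Any two vertices of a simplex span an edge, since every subset of its vertices spans a face.
  Therefore equality of the edge lengths is equality of all mutual distances of the vertices.
\<close>

lemma vertices_regular_simplex:
  fixes S :: "'a::euclidean_space set"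
  assumes "R > 0" and reg: "regular_simplex (int DIM('a)) S" and ins: "inscribed_in_ball S x0 R"
  shows "\<exists>l. inscribed_regular_simplex (vertices S) x0 R l"
proof -
  obtain C where C: "\<not> affine_dependent C" "int (card C) = int DIM('a) + 1" "S = convex hull C"
    using reg unfolding regular_simplex_def simplex_def by blast
  have V: "vertices S = C"
    unfolding vertices_def C(3) by (simp add: extreme_point_of_convex_hull_affine_independent[OF C(1)])
  obtain l where l: "\<And>u v. closed_segment u v edge_of S \<Longrightarrow> dist u v = l"
    using reg unfolding regular_simplex_def equal_edges_def by blast
  have "dist v w = l" if "v \<in> C" "w \<in> C" "v \<noteq> w" for v w
  proof (rule l)
    have "closed_segment v w face_of S"
      unfolding C(3) face_of_convex_hull_affine_independent[OF C(1)] segment_convex_hull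
      using that(1,2) by (intro exI[of _ "{v, w}"]) simp
    moreover have "aff_dim (closed_segment v w) = 1"
      using that(3) by (simp add: segment_convex_hull aff_dim_convex_hull)
    ultimately show "closed_segment v w edge_of S"
      by (simp add: edge_of_def)
  qed
  then have "inscribed_regular_simplex C x0 R l"
    using assms(1) C(1,2) ins unfolding inscribed_in_ball_def V
    by unfold_locales auto
  then show ?thesis using V by blast
qed


theorem theorem2:
  fixes x0 :: "real ^ 'n" and R :: real and S :: "(real ^ 'n) set"
    and P :: "(real ^ 'n \<Rightarrow> real) \<Rightarrow> (real ^ 'n \<Rightarrow> real)"
  assumes "R > 0"
    and "regular_simplex (int CARD('n)) S"
    and "inscribed_in_ball S x0 R"
    and "interpolation_projector (cball x0 R) (vertices S) P"
  shows "operator_norm (cball x0 R) P =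
           max (psi CARD('n) (of_int (split_index CARD('n))))
               (psi CARD('n) (of_int (split_index CARD('n) + 1)))
         \<and> sqrt (real CARD('n)) \<le> operator_norm (cball x0 R) P
         \<and> operator_norm (cball x0 R) P \<le> sqrt (real CARD('n) + 1)
         \<and> (operator_norm (cball x0 R) P = sqrt (real CARD('n)) \<longleftrightarrow> CARD('n) = 1)
         \<and> (operator_norm (cball x0 R) P = sqrt (real CARD('n) + 1)
              \<longleftrightarrow> sqrt (real CARD('n) + 1) \<in> \<int>)"
proof -
  let ?N = "operator_norm (cball x0 R) P"
  obtain l where "inscribed_regular_simplex (vertices S) x0 R l"
    using vertices_regular_simplex[of R S x0] assms by auto
  then interpret simplex_interpolation "vertices S" x0 R l P
    using assms(4) by (intro simplex_interpolation.intro simplex_interpolation_axioms.intro)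
  have n: "0 < CARD('n)" by simp
  define a where "a = nat (split_index CARD('n))"
  have a: "split_index CARD('n) = int a" "a + 1 \<le> CARD('n) + 1"
    using split_index_bounds[of "CARD('n)"] by (simp_all add: a_def)
  have N: "?N = max (psi CARD('n) (real a)) (psi CARD('n) (real (a + 1)))"
    using operator_norm_eq_max_psi unfolding a(1) by (simp add: add.commute)
  have upper: "psi CARD('n) (real k) \<le> sqrt (real CARD('n) + 1)" if "k \<le> CARD('n) + 1" for k
    using that by (intro psi_le_sqrt) simp_all
  have le: "?N \<le> sqrt (real CARD('n) + 1)"
    using upper[of a] upper[of "a + 1"] a(2) unfolding N by simp
  have lower: "sqrt (real CARD('n)) < ?N" if "CARD('n) \<noteq> 1"
  proof -
    have "2 \<le> CARD('n)" using that n by linarith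
    then obtain k where "k \<le> CARD('n) + 1" "sqrt (real CARD('n)) < psi CARD('n) (real k)"
      using ex_psi_gt_sqrt by blast
    then show ?thesis using psi_le_operator_norm[of k] by linarith
  qed
  have one: "?N = sqrt (real CARD('n))" if c: "CARD('n) = 1"
  proof -
    have "a = 0 \<or> a = 1" using a(2) c by auto
    moreover have "psi 1 (real k) = 1" if "k \<le> 2" for k :: nat
      using that by (cases k rule: nat.exhaust) (auto simp: psi_def le_Suc_eq numeral_2_eq_2)
    ultimately have "psi 1 (real a) = 1" "psi 1 (real (a + 1)) = 1"
      by (metis le_add2 nat_1_add_1 one_le_numeral zero_le, metis add_0 nat_1_add_1 one_le_numeral order_refl)
    then show ?thesis unfolding N c by simp
  qed
  have int: "sqrt (real CARD('n) + 1) \<in> \<int>" if eq: "?N = sqrt (real CARD('n) + 1)"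
  proof -
    have "psi CARD('n) (real a) = sqrt (real CARD('n) + 1)
        \<or> psi CARD('n) (real (a + 1)) = sqrt (real CARD('n) + 1)"
      using eq unfolding N by linarith
    then obtain k where "k \<le> CARD('n) + 1" "psi CARD('n) (real k) = sqrt (real CARD('n) + 1)"
      using a(2) add_leD1 by blast
    then have "sqrt (real CARD('n) + 1) = \<bar>real CARD('n) + 1 - 2 * real k\<bar>"
      using psi_eq_sqrt_iff[of "real k" "CARD('n)"] by simp
    also have "\<dots> \<in> \<int>" by simp
    finally show ?thesis .
  qed
  have sqrt: "?N = sqrt (real CARD('n) + 1)" if "sqrt (real CARD('n) + 1) \<in> \<int>"
  proof (rule antisym[OF le])
    show "sqrt (real CARD('n) + 1) \<le> ?N"
      using psi_split_index_eq_sqrt[OF n that] operator_norm_eq_max_psi by simp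
  qed
  have ge: "sqrt (real CARD('n)) \<le> ?N"
    using lower one by (cases "CARD('n) = 1") simp_all
  show ?thesis
  proof (intro conjI operator_norm_eq_max_psi le ge iffI)
    show "CARD('n) = 1" if "?N = sqrt (real CARD('n))"
      using lower that by fastforce
  qed (fact one, fact int, fact sqrt)
qed

end
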